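(* The following polynomials form a basis for the $\mathbb{Z}_2$-graded identities of the algebra $\mathcal{A}^2$, that is, they generate $\mathrm{Id}_{\mathbb{Z}_2}(\mathcal{A}^2)$ as a $\mathbb{Z}_2$-graded T-ideal: (i) $z_1z_2$; (ii) $[y_1,y_2][y_3,y_4]$; (iii) $z_1[y_1,y_2]$; (iv) $[[y_1,y_2]z_1,y_3]$.
   Context: $K$ is a field of characteristic zero, $e_{i,j}$ are the matrix units of $M_3(K)$, and $A = K(e_{1,1}+e_{3,3})\oplus Ke_{2,2}\oplus Ke_{1,2}\oplus Ke_{2,3}\oplus Ke_{1,3}$. $\mathcal{A}^2$ denotes $A$ with the $\mathbb{Z}_2$-grading $A_0=\mathrm{Span}(e_{1,1}+e_{3,3},e_{2,2},e_{1,2})$, $A_1=\mathrm{Span}(e_{1,3},e_{2,3})$. $K\langle Y,Z\rangle$ is the free unital associative algebra on the variables $y_1,y_2,\dots$ of degree $0$ and $z_1,z_2,\dots$ of degree $1$, with the induced $\mathbb{Z}_2$-grading. A polynomial $f(y_1,\dots,y_m,z_1,\dots,z_n)$ is a $\mathbb{Z}_2$-graded identity of a $\mathbb{Z}_2$-graded algebra $B=B_0\oplus B_1$ if it vanishes whenever the $y_i$ are replaced by elements of $B_0$ and the $z_j$ by elements of $B_1$; $\mathrm{Id}_{\mathbb{Z}_2}(B)$ is the ideal of all of them. A $\mathbb{Z}_2$-graded T-ideal is an ideal of $K\langle Y,Z\rangle$ closed under all degree-preserving endomorphisms of $K\langle Y,Z\rangle$. $[a,b]=ab-ba$. *)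

theory Defs
  imports "HOL-Analysis.Analysis" "HOL-Library.Poly_Mapping"
begin

section \<open>The free associative algebra with its \<open>Z\<^sub>2\<close>-grading\<close>

text \<open>The variables are indexed by all of \<^typ>\<open>nat\<close>; starting at 0 instead of 1 only renames them.\<close>

datatype var = Y nat | Z nat

datatype mon = Mon (vars: "var list")

instantiation mon :: monoid_add
begin
definition zero_mon :: mon where "0 = Mon []"
definition plus_mon :: "mon \<Rightarrow> mon \<Rightarrow> mon" where "u + v = Mon (vars u @ vars v)"
instance by standard (simp_all add: zero_mon_def plus_mon_def)
end

text \<open>
  The monoid of words is written additively because \<^theory>\<open>HOL-Library.Poly_Mapping\<close> takes the
  convolution product over an additive monoid.  Concatenation is not commutative, so this
  makes \<open>'k free_alg\<close> the noncommutative monoid algebra of the free monoid.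
\<close>

type_synonym 'k free_alg = "mon \<Rightarrow>\<^sub>0 'k"

definition X :: "var \<Rightarrow> 'k::zero_neq_one free_alg"
  where "X v = Poly_Mapping.single (Mon [v]) 1"

abbreviation y :: "nat \<Rightarrow> 'k::zero_neq_one free_alg" where "y i \<equiv> X (Y i)"
abbreviation z :: "nat \<Rightarrow> 'k::zero_neq_one free_alg" where "z i \<equiv> X (Z i)"

definition const :: "'k::zero \<Rightarrow> 'k free_alg"
  where "const c = Poly_Mapping.single 0 c"

definition comm :: "'a::ring \<Rightarrow> 'a \<Rightarrow> 'a"
  where "comm a b = a * b - b * a"

definition mon_degree :: "mon \<Rightarrow> nat"
  where "mon_degree w = length (filter (\<lambda>v. \<exists>i. v = Z i) (vars w)) mod 2"

definition free_component :: "nat \<Rightarrow> 'k::zero free_alg set"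
  where "free_component d = {f. \<forall>w\<in>Poly_Mapping.keys f. mon_degree w = d}"


section \<open>Graded T-ideals\<close>

definition algebra_endo :: "('k::ring_1 free_alg \<Rightarrow> 'k free_alg) \<Rightarrow> bool"
  where "algebra_endo \<phi> \<longleftrightarrow>
    \<phi> 1 = 1 \<and>
    (\<forall>f g. \<phi> (f + g) = \<phi> f + \<phi> g) \<and>
    (\<forall>f g. \<phi> (f * g) = \<phi> f * \<phi> g) \<and>
    (\<forall>c f. \<phi> (const c * f) = const c * \<phi> f)"

definition graded_endo :: "('k::ring_1 free_alg \<Rightarrow> 'k free_alg) \<Rightarrow> bool"
  where "graded_endo \<phi> \<longleftrightarrow> algebra_endo \<phi> \<and>
    (\<forall>d\<in>{0, 1}. \<phi> ` free_component d \<subseteq> free_component d)"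

definition two_sided_ideal :: "'a::ring_1 set \<Rightarrow> bool"
  where "two_sided_ideal I \<longleftrightarrow> 0 \<in> I \<and>
    (\<forall>f\<in>I. \<forall>g\<in>I. f + g \<in> I) \<and>
    (\<forall>f\<in>I. \<forall>h. h * f \<in> I \<and> f * h \<in> I)"

definition graded_T_ideal :: "'k::ring_1 free_alg set \<Rightarrow> bool"
  where "graded_T_ideal I \<longleftrightarrow> two_sided_ideal I \<and> (\<forall>\<phi>. graded_endo \<phi> \<longrightarrow> \<phi> ` I \<subseteq> I)"


section \<open>Graded identities of graded matrix algebras\<close>

text \<open>
  The multiplication of matrices is \<open>**\<close> and the identity matrix is \<^term>\<open>mat 1\<close>; the type class
  operations \<open>*\<close> and \<open>1\<close> on \<open>'k^'n^'n\<close> are entrywise and are not used.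
\<close>

definition mat_scale :: "'k::times \<Rightarrow> 'k^'n^'n \<Rightarrow> 'k^'n^'n"
  where "mat_scale c M = map_matrix ((*) c) M"

definition eval_mon :: "(var \<Rightarrow> 'k::semiring_1^'n^'n) \<Rightarrow> mon \<Rightarrow> 'k^'n^'n"
  where "eval_mon \<rho> w = foldr (\<lambda>v M. \<rho> v ** M) (vars w) (mat 1)"

definition eval :: "(var \<Rightarrow> 'k::semiring_1^'n^'n) \<Rightarrow> 'k free_alg \<Rightarrow> 'k^'n^'n"
  where "eval \<rho> f =
    (\<Sum>w\<in>Poly_Mapping.keys f. mat_scale (Poly_Mapping.lookup f w) (eval_mon \<rho> w))"

definition graded_identities :: "('k::semiring_1^'n^'n) set \<Rightarrow> ('k^'n^'n) set \<Rightarrow> 'k free_alg set"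
  where "graded_identities B\<^sub>0 B\<^sub>1 =
    {f. \<forall>\<rho>. (\<forall>i. \<rho> (Y i) \<in> B\<^sub>0) \<and> (\<forall>j. \<rho> (Z j) \<in> B\<^sub>1) \<longrightarrow> eval \<rho> f = 0}"


section \<open>The graded algebra \<open>A\<close>\<close>

global_interpretation mat_vs: vector_space "mat_scale :: 'k::field \<Rightarrow> 'k^'n^'n \<Rightarrow> 'k^'n^'n"
  by standard (simp_all add: mat_scale_def vec_eq_iff algebra_simps)

definition mat_unit :: "'n \<Rightarrow> 'n \<Rightarrow> 'k::zero_neq_one^'n^'n"
  where "mat_unit i j = (\<chi> a b. if a = i \<and> b = j then 1 else 0)"

definition A :: "('k::field^3^3) set"
  where "A = mat_vs.span
    {mat_unit 1 1 + mat_unit 3 3, mat_unit 2 2, mat_unit 1 2, mat_unit 2 3, mat_unit 1 3}"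

definition A\<^sub>0 :: "('k::field^3^3) set"
  where "A\<^sub>0 = mat_vs.span {mat_unit 1 1 + mat_unit 3 3, mat_unit 2 2, mat_unit 1 2}"

definition A\<^sub>1 :: "('k::field^3^3) set"
  where "A\<^sub>1 = mat_vs.span {mat_unit 1 3, mat_unit 2 3}"

lemmas mat3_simps = vec_eq_iff forall_3 sum_3 matrix_matrix_mult_def mat_def mat_scale_def mat_unit_def

lemma mem_A: "M \<in> A \<longleftrightarrow> M$1$1 = M$3$3 \<and> M$2$1 = 0 \<and> M$3$1 = 0 \<and> M$3$2 = 0"
  unfolding A_def mat_vs.span_insert mat_vs.span_empty
  by (auto simp: mat3_simps)

lemma mem_A\<^sub>0: "M \<in> A\<^sub>0 \<longleftrightarrow> M \<in> A \<and> M$1$3 = 0 \<and> M$2$3 = 0"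
  unfolding mem_A A\<^sub>0_def mat_vs.span_insert mat_vs.span_empty
  by (auto simp: mat3_simps)

lemma mem_A\<^sub>1: "M \<in> A\<^sub>1 \<longleftrightarrow> M \<in> A \<and> M$1$1 = 0 \<and> M$2$2 = 0 \<and> M$1$2 = 0"
  unfolding mem_A A\<^sub>1_def mat_vs.span_insert mat_vs.span_empty
  by (auto simp: mat3_simps)

lemma A_graded_algebra:
  shows "mat 1 \<in> A\<^sub>0"
    and "A = {a + b |a b. a \<in> A\<^sub>0 \<and> b \<in> A\<^sub>1}"
    and "A\<^sub>0 \<inter> A\<^sub>1 = {0}"
    and "a \<in> A\<^sub>0 \<Longrightarrow> b \<in> A\<^sub>0 \<Longrightarrow> a ** b \<in> A\<^sub>0"
    and "a \<in> A\<^sub>0 \<Longrightarrow> b \<in> A\<^sub>1 \<Longrightarrow> a ** b \<in> A\<^sub>1"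
    and "a \<in> A\<^sub>1 \<Longrightarrow> b \<in> A\<^sub>0 \<Longrightarrow> a ** b \<in> A\<^sub>1"
    and "a \<in> A\<^sub>1 \<Longrightarrow> b \<in> A\<^sub>1 \<Longrightarrow> a ** b \<in> A\<^sub>0"
proof -
  show "A = {a + b |a b. a \<in> A\<^sub>0 \<and> b \<in> A\<^sub>1}"
    unfolding A_def A\<^sub>0_def A\<^sub>1_def mat_vs.span_Un[symmetric]
    by (simp add: insert_commute)
qed (auto simp: mem_A mem_A\<^sub>0 mem_A\<^sub>1 mat3_simps)

end

theory Submission
  imports Defs
begin

text \<open>
  One inclusion is a matrix calculation: commutators of elements of \<open>A\<^sub>0\<close> are multiples of
  \<open>e\<^sub>1\<^sub>2\<close>, and \<open>A\<^sub>1\<close> is spanned by \<open>e\<^sub>1\<^sub>3\<close> and \<open>e\<^sub>2\<^sub>3\<close>, so that the first three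
  polynomials vanish; and \<open>e\<^sub>1\<^sub>2 e\<^sub>2\<^sub>3 = e\<^sub>1\<^sub>3\<close> commutes with \<open>A\<^sub>0\<close>, since the (1,1) and
  (3,3) entries there agree, which gives the fourth.  The graded identities form a graded T-ideal
  because evaluation is a homomorphism, and composing it with a graded endomorphism only changes the
  point of evaluation.

  For the other inclusion, let \<open>J\<close> be a graded T-ideal that contains the four polynomials.  Modulo
  \<open>J\<close> every word with two odd variables is zero.  Write \<open>S(M)\<close> for the increasing word in the even
  variables with index multiset \<open>M\<close>.  A word \<open>u\<close> in the even variables is sorted letter by letter
  from the left, and \<open>u - S(u)\<close> telescopes into the terms
  \<open>(S(a) y\<^sub>d - S(a d)) b\<close>, one for each factorization \<open>u = a d b\<close>.  The bracket lies in the
  commutator ideal, and products of two commutators vanish modulo \<open>J\<close>, so \<open>b\<close> may be replaced by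
  \<open>S(b)\<close>: the term depends on the letter \<open>d\<close> and on the multisets of letters of \<open>a\<close> and \<open>b\<close> only
  (\<open>sorting_formula\<close>).  These triples index exactly the monomials of the (1,2) entry of the value
  of \<open>u\<close> at a generic even point, while \<open>S(u)\<close> depends on the monomial in the (1,1) entry.  For
  a word \<open>u z\<^sub>j v\<close> with a single odd variable, \<open>v\<close> may be sorted, and a commutator multiplied by
  an odd element commutes with even elements, so \<open>(u - S(u)) z\<^sub>j v\<close> becomes
  \<open>S(v) (u - S(u)) z\<^sub>j\<close>, which is a difference of two sums of the same kind
  (\<open>one_z_formula\<close>); one of them is governed by the (1,3) entry, and all that remains by the
  (2,3) entry.

  Hence every polynomial is congruent modulo \<open>J\<close> to a combination of terms, each of which is
  determined by a monomial in one of the four entries of the generic value.  If the polynomial is an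
  identity, these entries vanish identically; distinct monomials are linearly independent as functions
  (\<open>monomial_funs_independent\<close>), so the total coefficient of each term is zero
  (\<open>monomial_relation_transfer\<close>).
\<close>

section \<open>Linear maps out of the free algebra\<close>

abbreviation coeff :: "'k::zero free_alg \<Rightarrow> mon \<Rightarrow> 'k" where "coeff \<equiv> Poly_Mapping.lookup"
abbreviation keys :: "'k::zero free_alg \<Rightarrow> mon set" where "keys \<equiv> Poly_Mapping.keys"

definition word :: "var list \<Rightarrow> 'k::ring_1 free_alg"
  where "word l = prod_list (map X l)"

lemma word_append: "word (u @ v) = word u * word v"
  by (simp add: word_def)

lemma word_Nil [simp]: "word [] = 1"
  by (simp add: word_def)

lemma word_Cons: "word (v # l) = X v * word l"
  by (simp add: word_def)

lemma word_eq_single: "word l = Poly_Mapping.single (Mon l) 1"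
proof (induction l)
  case Nil
  show ?case by (metis single_one word_Nil zero_mon_def)
next
  case (Cons v l)
  then show ?case by (simp add: word_Cons X_def mult_single plus_mon_def)
qed

lemma const_mult_word: "const c * word l = Poly_Mapping.single (Mon l) (c::'k::ring_1)"
  by (simp add: word_eq_single const_def mult_single)

lemma const_add: "const (a + b) = const a + const (b::'k::monoid_add)"
  by (simp add: const_def single_add)

lemma const_mult: "const (a * b) = const a * const (b::'k::ring_1)"
  by (simp add: const_def mult_single)

lemma const_0 [simp]: "const 0 = 0"
  by (simp add: const_def)

lemma const_1 [simp]: "const (1::'k::ring_1) = 1"
  by (simp add: const_def)

lemma const_sum: "const (sum f S) = (\<Sum>i\<in>S. const (f i::'k::ring_1))"
  by (induction S rule: infinite_finite_induct) (simp_all add: const_add)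

lemma poly_expand: "f = (\<Sum>w\<in>keys f. const (coeff f w) * word (vars w))" for f :: "'k::ring_1 free_alg"
proof (rule poly_mapping_eqI)
  fix w
  have "coeff (\<Sum>v\<in>keys f. const (coeff f v) * word (vars v)) w
      = (\<Sum>v\<in>keys f. if v = w then coeff f v else 0)"
    by (simp add: const_mult_word lookup_sum lookup_single when_def)
  also have "\<dots> = coeff f w"
    by (simp add: in_keys_iff)
  finally show "coeff f w = coeff (\<Sum>v\<in>keys f. const (coeff f v) * word (vars v)) w" ..
qed

lemma free_alg_induct [case_names zero monomial add]:
  fixes f :: "'k::ring_1 free_alg"
  assumes "P 0" "\<And>c l. P (const c * word l)" "\<And>f g. P f \<Longrightarrow> P g \<Longrightarrow> P (f + g)"
  shows "P f"
proof -
  have "P (\<Sum>w\<in>S. const (coeff f w) * word (vars w))" if "finite S" for S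
    using that by (induction S) (simp_all add: assms)
  then show ?thesis
    using poly_expand[of f] by (metis finite_keys)
qed

text \<open>
  Substitutions into the free algebra and evaluations in matrices are both of this form.  The matrix
  product is not the type class operation, hence the abstract product \<open>m\<close> in the multiplicativity
  lemma below.
\<close>

definition monomialwise :: "('k::zero \<Rightarrow> mon \<Rightarrow> 'b::ab_group_add) \<Rightarrow> 'k free_alg \<Rightarrow> 'b"
  where "monomialwise h f = (\<Sum>w\<in>keys f. h (coeff f w) w)"

locale additive_coeff =
  fixes h :: "'k::ring_1 \<Rightarrow> mon \<Rightarrow> 'b::ab_group_add"
  assumes additive: "h (a + b) w = h a w + h b w"
begin

lemma zero [simp]: "h 0 w = 0"
  using additive[of 0 0 w] by simp

lemma monomialwise_add: "monomialwise h (f + g) = monomialwise h f + monomialwise h g"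
  unfolding monomialwise_def by (rule setsum_keys_plus_distrib) (simp_all add: additive)

lemma monomialwise_0: "monomialwise h 0 = 0"
  by (simp add: monomialwise_def)

lemma monomialwise_monomial: "monomialwise h (const c * word l) = h c (Mon l)"
  by (simp add: monomialwise_def const_mult_word)

lemma monomialwise_mult:
  assumes "\<And>x y z. m (x + y) z = m x z + m y z" "\<And>x y z. m x (y + z) = m x y + m x z"
    and "\<And>a b u v. h (a * b) (u + v) = m (h a u) (h b v)"
  shows "monomialwise h (f * g) = m (monomialwise h f) (monomialwise h g)"
proof -
  have m0: "m 0 x = 0" "m x 0 = 0" for x
    using assms(1)[of 0 0 x] assms(2)[of x 0 0] by simp_all
  show ?thesis
  proof (induction f rule: free_alg_induct)
    case zero
    show ?case by (simp add: monomialwise_0 m0)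
  next
    case (monomial c l)
    show ?case
    proof (induction g rule: free_alg_induct)
      case zero
      show ?case by (simp add: monomialwise_0 m0)
    next
      case (monomial d k)
      have "const c * word l * (const d * word k) = const (c * d) * word (l @ k)"
        by (simp add: const_mult_word mult_single plus_mon_def)
      moreover have "Mon (l @ k) = Mon l + Mon k"
        by (simp add: plus_mon_def)
      ultimately show ?case
        by (simp add: monomialwise_monomial assms(3))
    qed (simp add: distrib_left monomialwise_add assms(2))
  qed (simp add: distrib_right monomialwise_add assms(1))
qed

end

section \<open>Substitutions and grading\<close>

definition subst :: "(var \<Rightarrow> 'k::comm_ring_1 free_alg) \<Rightarrow> 'k free_alg \<Rightarrow> 'k free_alg"
  where "subst \<theta> = monomialwise (\<lambda>c w. const c * prod_list (map \<theta> (vars w)))"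

lemma const_commute: "const (c::'k::comm_ring_1) * f = f * const c"
proof (induction f rule: free_alg_induct)
  case (monomial d l)
  show ?case
    unfolding const_mult_word by (simp add: const_def mult_single mult.commute)
qed (simp_all add: algebra_simps)

lemma subst_word:
  fixes \<theta> :: "var \<Rightarrow> 'k::comm_ring_1 free_alg"
  shows "subst \<theta> (word l) = prod_list (map \<theta> l)"
proof -
  interpret additive_coeff "\<lambda>c w. const (c::'k) * prod_list (map \<theta> (vars w))"
    by standard (simp add: const_add distrib_right)
  show ?thesis
    using monomialwise_monomial[of 1 l] by (simp add: subst_def)
qed

lemma subst_X [simp]: "subst \<theta> (X v) = \<theta> v"
  using subst_word[of \<theta> "[v]"] by (simp add: word_Cons)

lemma subst_endo: "algebra_endo (subst \<theta>)" for \<theta> :: "var \<Rightarrow> 'k::comm_ring_1 free_alg"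
proof -
  interpret additive_coeff "\<lambda>c w. const (c::'k) * prod_list (map \<theta> (vars w))"
    by standard (simp add: const_add distrib_right)
  have mult: "subst \<theta> (f * g) = subst \<theta> f * subst \<theta> g" for f g
    unfolding subst_def
  proof (rule monomialwise_mult)
    fix a b :: 'k and u v
    have "const (a * b) * prod_list (map \<theta> (vars (u + v)))
      = const a * (const b * prod_list (map \<theta> (vars u))) * prod_list (map \<theta> (vars v))"
      by (simp add: const_mult plus_mon_def mult.assoc)
    also have "const b * prod_list (map \<theta> (vars u)) = prod_list (map \<theta> (vars u)) * const b"
      by (rule const_commute)
    finally show "const (a * b) * prod_list (map \<theta> (vars (u + v)))
      = const a * prod_list (map \<theta> (vars u)) * (const b * prod_list (map \<theta> (vars v)))"
      by (simp add: mult.assoc)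
  qed (simp_all add: algebra_simps)
  have "subst \<theta> (const c) = const c" for c
    using monomialwise_monomial[of c "[]"] by (simp add: subst_def)
  moreover have "subst \<theta> 1 = 1"
    using subst_word[of \<theta> "[]"] by simp
  ultimately show ?thesis
    unfolding algebra_endo_def using mult monomialwise_add by (simp add: subst_def)
qed

lemma algebra_endo_0: "algebra_endo \<phi> \<Longrightarrow> \<phi> 0 = 0"
  unfolding algebra_endo_def by (metis add_cancel_right_left)

lemma algebra_endo_diff: "algebra_endo \<phi> \<Longrightarrow> \<phi> (f - g) = \<phi> f - \<phi> g"
  unfolding algebra_endo_def by (metis add_diff_cancel diff_add_cancel)

lemma algebra_endo_word:
  assumes "algebra_endo \<phi>"
  shows "\<phi> (word l) = prod_list (map (\<lambda>v. \<phi> (X v)) l)"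
proof -
  have "\<phi> 1 = 1" "\<phi> (f * g) = \<phi> f * \<phi> g" for f g
    using assms by (simp_all add: algebra_endo_def)
  then show ?thesis
    by (induction l) (simp_all add: word_Cons)
qed

abbreviation "even_part \<equiv> free_component 0"
abbreviation "odd_part \<equiv> free_component 1"

lemma mon_degree_add: "mon_degree (u + v) = (mon_degree u + mon_degree v) mod 2"
  by (simp add: mon_degree_def plus_mon_def mod_add_eq)

lemma free_component_mult:
  "f \<in> free_component a \<Longrightarrow> g \<in> free_component b \<Longrightarrow> f * g \<in> free_component ((a + b) mod 2)"
  using keys_mult[of f g] by (fastforce simp: free_component_def mon_degree_add)

lemma free_component_add:
  "f \<in> free_component a \<Longrightarrow> g \<in> free_component a \<Longrightarrow> f + g \<in> free_component a"
  using keys_add[of f g] by (fastforce simp: free_component_def)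

lemma free_component_0: "0 \<in> free_component a"
  by (simp add: free_component_def)

lemma even_mult: "f \<in> even_part \<Longrightarrow> g \<in> even_part \<Longrightarrow> f * g \<in> even_part"
  and odd_even_mult: "f \<in> odd_part \<Longrightarrow> g \<in> even_part \<Longrightarrow> f * g \<in> odd_part"
  and even_odd_mult: "f \<in> even_part \<Longrightarrow> g \<in> odd_part \<Longrightarrow> f * g \<in> odd_part"
  using free_component_mult[of f 0 g 0] free_component_mult[of f 1 g 0]
    free_component_mult[of f 0 g 1] by simp_all

lemma const_even: "const c \<in> even_part"
  by (auto simp: free_component_def const_def mon_degree_def zero_mon_def split: if_splits)

lemma one_even: "(1::'k::ring_1 free_alg) \<in> even_part"
  using const_even[of "1::'k"] by simp

lemma y_even: "y i \<in> even_part" and z_odd: "z i \<in> odd_part"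
  by (auto simp: free_component_def X_def mon_degree_def)

definition yword :: "nat list \<Rightarrow> 'k::ring_1 free_alg"
  where "yword l = word (map Y l)"

lemma yword_simps [simp]: "yword [] = 1" "yword (i # l) = y i * yword l"
  "yword (l @ k) = yword l * yword k"
  by (simp_all add: yword_def word_Cons word_append)

lemma yword_even: "yword l \<in> even_part"
  by (induction l) (simp_all add: one_even y_even even_mult)

lemma subst_graded:
  fixes \<theta> :: "var \<Rightarrow> 'k::comm_ring_1 free_alg"
  assumes "\<And>i. \<theta> (Y i) \<in> even_part" "\<And>j. \<theta> (Z j) \<in> odd_part"
  shows "graded_endo (subst \<theta>)"
proof -
  have prod: "prod_list (map \<theta> l) \<in> free_component (mon_degree (Mon l))" for l
  proof (induction l)
    case Nil
    show ?case by (simp add: mon_degree_def one_even)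
  next
    case (Cons v l)
    have "\<theta> v \<in> free_component (mon_degree (Mon [v]))"
      using assms by (cases v) (simp_all add: mon_degree_def)
    from free_component_mult[OF this Cons.IH] show ?case
      by (simp add: mon_degree_add[symmetric] plus_mon_def)
  qed
  have "subst \<theta> f \<in> free_component d" if f: "f \<in> free_component d" and d: "d \<in> {0, 1}" for f d
  proof -
    have "(\<Sum>w\<in>S. const (coeff f w) * prod_list (map \<theta> (vars w))) \<in> free_component d"
      if "finite S" "S \<subseteq> keys f" for S
      using that
    proof (induction S)
      case empty
      show ?case by (simp add: free_component_0)
    next
      case (insert w S)
      then have "mon_degree w = d"
        using f by (simp add: free_component_def)
      with prod[of "vars w"] have "prod_list (map \<theta> (vars w)) \<in> free_component d"
        by simp
      from free_component_mult[OF const_even this] d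
      have "const (coeff f w) * prod_list (map \<theta> (vars w)) \<in> free_component d"
        by auto
      with insert show ?case by (simp add: free_component_add)
    qed
    then show ?thesis
      by (simp add: subst_def monomialwise_def)
  qed
  then show ?thesis
    unfolding graded_endo_def using subst_endo by blast
qed

section \<open>Evaluation\<close>

lemma eval_eq_monomialwise: "eval \<rho> = monomialwise (\<lambda>c w. mat_scale c (eval_mon \<rho> w))"
  by (rule ext) (simp add: eval_def monomialwise_def)

lemma eval_mon_Cons: "eval_mon \<rho> (Mon (v # l)) = \<rho> v ** eval_mon \<rho> (Mon l)"
  by (simp add: eval_mon_def)

lemma eval_mon_Nil: "eval_mon \<rho> (Mon []) = mat 1"
  by (simp add: eval_mon_def)

lemma eval_mon_add:
  fixes \<rho> :: "var \<Rightarrow> 'k::field^'n^'n"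
  shows "eval_mon \<rho> (u + v) = eval_mon \<rho> u ** eval_mon \<rho> v"
proof -
  have "eval_mon \<rho> (Mon (l @ k)) = eval_mon \<rho> (Mon l) ** eval_mon \<rho> (Mon k)" for l k
    by (induction l) (simp_all add: eval_mon_Cons eval_mon_Nil matrix_mul_assoc)
  then show ?thesis
    by (simp add: plus_mon_def)
qed

lemma mat_scale_mult:
  fixes M N :: "'k::field^'n^'n"
  shows "mat_scale (a * b) (M ** N) = mat_scale a M ** mat_scale b N"
  by (simp add: mat_scale_def matrix_matrix_mult_def vec_eq_iff sum_distrib_left mult_ac)

lemma additive_eval: "additive_coeff (\<lambda>c w. mat_scale c (eval_mon \<rho> w))"
  for \<rho> :: "var \<Rightarrow> 'k::field^'n^'n"
  by standard (rule mat_vs.scale_left_distrib)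

lemma eval_add: "eval \<rho> (f + g) = eval \<rho> f + eval \<rho> g"
  and eval_zero: "eval \<rho> 0 = 0"
  and eval_mult: "eval \<rho> (f * g) = eval \<rho> f ** eval \<rho> g"
  and eval_monomial: "eval \<rho> (const c * word l) = mat_scale c (eval_mon \<rho> (Mon l))"
  for \<rho> :: "var \<Rightarrow> 'k::field^'n^'n"
proof -
  interpret additive_coeff "\<lambda>c w. mat_scale c (eval_mon \<rho> w)"
    by (rule additive_eval)
  show "eval \<rho> (f + g) = eval \<rho> f + eval \<rho> g"
    and "eval \<rho> 0 = 0"
    and "eval \<rho> (const c * word l) = mat_scale c (eval_mon \<rho> (Mon l))"
    by (simp_all only: eval_eq_monomialwise monomialwise_add monomialwise_0 monomialwise_monomial)
  show "eval \<rho> (f * g) = eval \<rho> f ** eval \<rho> g"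
    unfolding eval_eq_monomialwise
    by (rule monomialwise_mult)
      (simp_all add: matrix_matrix_mult_def vec_eq_iff distrib_left distrib_right sum.distrib
        mat_scale_mult[unfolded matrix_matrix_mult_def vec_eq_iff] eval_mon_add)
qed

lemma eval_word: "eval \<rho> (word l) = eval_mon \<rho> (Mon l)" for \<rho> :: "var \<Rightarrow> 'k::field^'n^'n"
  using eval_monomial[of \<rho> 1 l] by simp

lemma eval_X: "eval \<rho> (X v) = \<rho> v" for \<rho> :: "var \<Rightarrow> 'k::field^'n^'n"
  using eval_word[of \<rho> "[v]"] by (simp add: word_Cons eval_mon_Cons eval_mon_Nil)

lemma eval_diff: "eval \<rho> (f - g) = eval \<rho> f - eval \<rho> g" for \<rho> :: "var \<Rightarrow> 'k::field^'n^'n"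
  using eval_add[of \<rho> "f - g" g] by (simp add: algebra_simps)

text \<open>
  Composing with an endomorphism only moves the point of evaluation; this is why the identities are
  closed under graded endomorphisms.
\<close>

lemma eval_comp_endo:
  fixes \<rho> :: "var \<Rightarrow> 'k::field^'n^'n"
  assumes "algebra_endo \<phi>"
  shows "eval \<rho> (\<phi> f) = eval (\<lambda>v. eval \<rho> (\<phi> (X v))) f"
proof (induction f rule: free_alg_induct)
  case zero
  then show ?case by (simp add: algebra_endo_0[OF assms] eval_zero)
next
  case (monomial c l)
  have word: "eval \<rho> (\<phi> (word l)) = eval_mon (\<lambda>v. eval \<rho> (\<phi> (X v))) (Mon l)"
    unfolding algebra_endo_word[OF assms]
  proof (induction l)
    case Nil
    then show ?case using eval_word[of \<rho> "[]"] by (simp add: eval_mon_Nil)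
  qed (simp add: eval_mult eval_mon_Cons)
  have "\<phi> (const c * word l) = const c * \<phi> (word l)"
    using assms unfolding algebra_endo_def by blast
  moreover have "eval \<rho> (const c * g) = mat_scale c (eval \<rho> g)" for g
  proof -
    have "eval \<rho> (const c) = mat_scale c (mat 1)"
      using eval_monomial[of \<rho> c "[]"] by (simp add: eval_mon_Nil)
    then show ?thesis
      using mat_scale_mult[of c 1 "mat 1" "eval \<rho> g"] by (simp add: eval_mult)
  qed
  ultimately show ?case
    by (simp add: word eval_monomial)
next
  case (add f g)
  then show ?case using assms by (simp add: algebra_endo_def eval_add)
qed

definition graded_point :: "(var \<Rightarrow> 'k::field^3^3) \<Rightarrow> bool"
  where "graded_point \<rho> \<longleftrightarrow> (\<forall>i. \<rho> (Y i) \<in> A\<^sub>0) \<and> (\<forall>j. \<rho> (Z j) \<in> A\<^sub>1)"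

lemma mem_graded_identities: "f \<in> graded_identities A\<^sub>0 A\<^sub>1 \<longleftrightarrow> (\<forall>\<rho>. graded_point \<rho> \<longrightarrow> eval \<rho> f = 0)"
  by (simp add: graded_identities_def graded_point_def)

lemma eval_mon_graded:
  assumes "graded_point \<rho>"
  shows "mon_degree (Mon l) = 0 \<and> eval_mon \<rho> (Mon l) \<in> A\<^sub>0 \<or>
    mon_degree (Mon l) = 1 \<and> eval_mon \<rho> (Mon l) \<in> A\<^sub>1"
proof (induction l)
  case Nil
  then show ?case by (simp add: mon_degree_def eval_mon_Nil A_graded_algebra)
next
  case (Cons v l)
  have deg: "mon_degree (Mon (v # l)) = (mon_degree (Mon [v]) + mon_degree (Mon l)) mod 2"
    by (simp add: mon_degree_add[symmetric] plus_mon_def)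
  show ?case
  proof (cases v)
    case (Y i)
    then have "\<rho> v \<in> A\<^sub>0" "mon_degree (Mon [v]) = 0"
      using assms by (simp_all add: graded_point_def mon_degree_def)
    with Cons deg show ?thesis
      by (auto simp: eval_mon_Cons intro: A_graded_algebra)
  next
    case (Z j)
    then have "\<rho> v \<in> A\<^sub>1" "mon_degree (Mon [v]) = 1"
      using assms by (simp_all add: graded_point_def mon_degree_def)
    with Cons deg show ?thesis
      by (auto simp: eval_mon_Cons intro: A_graded_algebra)
  qed
qed

lemma eval_graded:
  assumes "graded_point \<rho>"
  shows "f \<in> even_part \<Longrightarrow> eval \<rho> f \<in> A\<^sub>0" and "f \<in> odd_part \<Longrightarrow> eval \<rho> f \<in> A\<^sub>1"
proof -
  have "eval_mon \<rho> w \<in> A\<^sub>0" if "f \<in> even_part" "w \<in> keys f" for w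
    using eval_mon_graded[OF assms, of "vars w"] that by (auto simp: free_component_def)
  then show "f \<in> even_part \<Longrightarrow> eval \<rho> f \<in> A\<^sub>0"
    unfolding eval_def A\<^sub>0_def by (auto intro!: mat_vs.span_sum mat_vs.span_scale)
  have "eval_mon \<rho> w \<in> A\<^sub>1" if "f \<in> odd_part" "w \<in> keys f" for w
    using eval_mon_graded[OF assms, of "vars w"] that by (auto simp: free_component_def)
  then show "f \<in> odd_part \<Longrightarrow> eval \<rho> f \<in> A\<^sub>1"
    unfolding eval_def A\<^sub>1_def by (auto intro!: mat_vs.span_sum mat_vs.span_scale)
qed

lemma graded_T_ideal_identities: "graded_T_ideal (graded_identities A\<^sub>0 A\<^sub>1 :: 'k::field free_alg set)"
  unfolding graded_T_ideal_def two_sided_ideal_def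
proof (intro conjI allI impI ballI subsetI)
  fix \<phi> :: "'k free_alg \<Rightarrow> 'k free_alg" and g
  assume \<phi>: "graded_endo \<phi>" and "g \<in> \<phi> ` graded_identities A\<^sub>0 A\<^sub>1"
  then obtain f where f: "f \<in> graded_identities A\<^sub>0 A\<^sub>1" and g: "g = \<phi> f"
    by auto
  have "\<phi> (y i) \<in> even_part" "\<phi> (z i) \<in> odd_part" for i
    using \<phi> y_even z_odd unfolding graded_endo_def by blast+
  then have "graded_point (\<lambda>v. eval \<rho> (\<phi> (X v)))" if "graded_point \<rho>" for \<rho>
    using eval_graded[OF that] by (simp add: graded_point_def)
  with f \<phi> show "g \<in> graded_identities A\<^sub>0 A\<^sub>1"
    unfolding g mem_graded_identities by (auto simp: eval_comp_endo[of \<phi> _ f] graded_endo_def)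
qed (simp_all add: mem_graded_identities eval_add eval_mult eval_zero)

lemma generators_are_identities:
  "{z 1 * z 2, comm (y 1) (y 2) * comm (y 3) (y 4), z 1 * comm (y 1) (y 2),
    comm (comm (y 1) (y 2) * z 1) (y 3)} \<subseteq> (graded_identities A\<^sub>0 A\<^sub>1 :: 'k::field free_alg set)"
proof -
  have *: "eval \<rho> f = 0"
    if "graded_point \<rho>" "f \<in> {z 1 * z 2, comm (y 1) (y 2) * comm (y 3) (y 4),
      z 1 * comm (y 1) (y 2), comm (comm (y 1) (y 2) * z 1) (y 3)}"
    for \<rho> and f :: "'k free_alg"
  proof -
    have Y: "\<rho> (Y i)$3$3 = \<rho> (Y i)$1$1" "\<rho> (Y i)$2$1 = 0" "\<rho> (Y i)$3$1 = 0"
      "\<rho> (Y i)$3$2 = 0" "\<rho> (Y i)$1$3 = 0" "\<rho> (Y i)$2$3 = 0" for i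
      using that(1) by (simp_all add: graded_point_def mem_A mem_A\<^sub>0)
    have Z0: "\<rho> (Z j) \<in> A" "\<rho> (Z j)$1$1 = 0" "\<rho> (Z j)$2$2 = 0" "\<rho> (Z j)$1$2 = 0" for j
      using that(1) by (simp_all add: graded_point_def mem_A\<^sub>1)
    then have Z1: "\<rho> (Z j)$1$1 = 0" "\<rho> (Z j)$2$2 = 0" "\<rho> (Z j)$1$2 = 0" "\<rho> (Z j)$3$3 = 0"
      "\<rho> (Z j)$2$1 = 0" "\<rho> (Z j)$3$1 = 0" "\<rho> (Z j)$3$2 = 0" for j
      by (metis mem_A)+
    show ?thesis
      using that(2) unfolding insert_iff empty_iff
      by (elim disjE FalseE; hypsubst; unfold comm_def eval_diff eval_mult eval_X)
        (simp_all add: Y Z1 vec_eq_iff forall_3 sum_3 matrix_matrix_mult_def algebra_simps)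
  qed
  then show ?thesis
    unfolding mem_graded_identities[abs_def] subset_iff by (simp add: mem_graded_identities)
qed


section \<open>Independence of monomial functions\<close>

definition monomial_fun :: "('i \<Rightarrow> 'k::comm_monoid_mult) \<Rightarrow> 'i multiset \<Rightarrow> 'k"
  where "monomial_fun x M = prod_mset (image_mset x M)"

lemma monomial_fun_simps [simp]:
  "monomial_fun x {#} = 1" "monomial_fun x (M + N) = monomial_fun x M * monomial_fun x N"
  "monomial_fun x (add_mset i M) = x i * monomial_fun x M"
  by (simp_all add: monomial_fun_def)

lemma monomial_fun_mult:
  "monomial_fun (\<lambda>i. x i * x' i) M = monomial_fun x M * monomial_fun x' M"
  by (induction M) (simp_all add: mult_ac)

text \<open>
  Setting one variable to 2 and all others to 1 reads off its exponent, since the powers of 2 are distinct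
  in characteristic zero.
\<close>

lemma monomial_fun_separates:
  assumes "M \<noteq> N"
  shows "\<exists>x::'i \<Rightarrow> 'k::field_char_0. monomial_fun x M \<noteq> monomial_fun x N"
proof -
  obtain i where "count M i \<noteq> count N i"
    using assms by (auto simp: multiset_eq_iff)
  moreover have "monomial_fun (\<lambda>j. if j = i then 2 else 1::'k) L = of_nat (2 ^ count L i)" for L
    by (induction L) simp_all
  ultimately show ?thesis
    by (metis of_nat_eq_iff power_inject_exp one_less_numeral_iff semiring_norm(76))
qed

text \<open>
  Dedekind's argument for characters: a monomial function is multiplicative under pointwise products of
  points.  Subtracting a multiple of the relation from its translate by \<open>x0\<close> removes the
  monomial \<open>N\<close> and keeps a nonzero multiple of any monomial that differs from \<open>N\<close> at \<open>x0\<close>.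
\<close>

lemma monomial_funs_independent:
  fixes c :: "'i multiset \<Rightarrow> 'k::field_char_0"
  assumes "finite S" "\<And>x. (\<Sum>M\<in>S. c M * monomial_fun x M) = 0" "M \<in> S"
  shows "c M = 0"
  using assms
proof (induction S arbitrary: c M)
  case empty
  then show ?case by simp
next
  case (insert N S)
  have S: "c L = 0" if L: "L \<in> S" for L
  proof -
    from L insert have "L \<noteq> N" by auto
    then obtain x0 :: "'i \<Rightarrow> 'k" where x0: "monomial_fun x0 L \<noteq> monomial_fun x0 N"
      using monomial_fun_separates by blast
    have "(\<Sum>M\<in>S. c M * (monomial_fun x0 M - monomial_fun x0 N) * monomial_fun x M) = 0" for x
    proof -
      have "(\<Sum>M\<in>S. c M * (monomial_fun x0 M - monomial_fun x0 N) * monomial_fun x M)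
        = (\<Sum>M\<in>insert N S. c M * monomial_fun (\<lambda>i. x0 i * x i) M)
          - monomial_fun x0 N * (\<Sum>M\<in>insert N S. c M * monomial_fun x M)"
        using insert.hyps
        by (simp add: monomial_fun_mult sum_distrib_left sum_subtractf algebra_simps)
      then show ?thesis
        by (simp only: insert.prems(1)) simp
    qed
    from insert.IH[OF this L] x0 show ?thesis by simp
  qed
  moreover have "c N = 0"
  proof -
    have "c N * monomial_fun (\<lambda>_. 1) N = 0"
      using insert.prems(1)[of "\<lambda>_. 1"] insert.hyps S by simp
    moreover have "monomial_fun (\<lambda>_. 1) N = (1::'k)"
      by (induction N) simp_all
    ultimately show ?thesis by simp
  qed
  ultimately show ?case using insert.prems by blast
qed

text \<open>
  If the terms \<open>T i\<close> depend only on monomials \<open>M i\<close>, a polynomial relation among the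
  monomials carries over to the terms, because the coefficients already add up to zero over each
  fibre of \<open>M\<close>.
\<close>

lemma monomial_relation_transfer:
  fixes c :: "'a \<Rightarrow> 'k::field_char_0" and T :: "'a \<Rightarrow> 'k free_alg"
  assumes "finite I" and rel: "\<And>x. (\<Sum>i\<in>I. c i * monomial_fun x (M i)) = 0"
    and T: "\<And>i j. i \<in> I \<Longrightarrow> j \<in> I \<Longrightarrow> M i = M j \<Longrightarrow> T i = T j"
  shows "(\<Sum>i\<in>I. const (c i) * T i) = 0"
proof -
  have fibre: "(\<Sum>i | i \<in> I \<and> M i = N. c i) = 0" if "N \<in> M ` I" for N
  proof (rule monomial_funs_independent[OF _ _ that])
    fix x
    have "(\<Sum>N\<in>M ` I. (\<Sum>i | i \<in> I \<and> M i = N. c i) * monomial_fun x N)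
      = (\<Sum>N\<in>M ` I. \<Sum>i | i \<in> I \<and> M i = N. c i * monomial_fun x (M i))"
      by (simp add: sum_distrib_right)
    also have "\<dots> = 0"
      using sum.image_gen[OF \<open>finite I\<close>, of "\<lambda>i. c i * monomial_fun x (M i)" M] rel by simp
    finally show "(\<Sum>N\<in>M ` I. (\<Sum>i | i \<in> I \<and> M i = N. c i) * monomial_fun x N) = 0" .
  qed (simp add: \<open>finite I\<close>)
  have "(\<Sum>i | i \<in> I \<and> M i = N. const (c i) * T i) = 0" if N: "N \<in> M ` I" for N
  proof -
    obtain i0 where i0: "i0 \<in> I" "N = M i0" using N by auto
    have "(\<Sum>i | i \<in> I \<and> M i = N. const (c i) * T i) = (\<Sum>i | i \<in> I \<and> M i = N. const (c i) * T i0)"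
      using T[OF _ i0(1)] i0(2) by (intro sum.cong refl arg_cong2[where f = "(*)"]) auto
    also have "\<dots> = const (\<Sum>i | i \<in> I \<and> M i = N. c i) * T i0"
      by (simp add: const_sum sum_distrib_right)
    finally show ?thesis using fibre[OF N] by simp
  qed
  then show ?thesis
    using sum.image_gen[OF \<open>finite I\<close>, of "\<lambda>i. const (c i) * T i" M] by simp
qed

section \<open>Consequences of the four polynomials\<close>

lemma subst_mult: "subst \<theta> (f * g) = subst \<theta> f * subst \<theta> g"
  and subst_diff: "subst \<theta> (f - g) = subst \<theta> f - subst \<theta> g"
  for \<theta> :: "var \<Rightarrow> 'k::comm_ring_1 free_alg"
  using subst_endo[of \<theta>] algebra_endo_diff[OF subst_endo, of \<theta>] unfolding algebra_endo_def by blast+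

lemma subst_comm: "subst \<theta> (comm f g) = comm (subst \<theta> f) (subst \<theta> g)"
  for \<theta> :: "var \<Rightarrow> 'k::comm_ring_1 free_alg"
  by (simp add: comm_def subst_mult subst_diff)

text \<open>
  A rearrangement is undone by moving one letter at a time to its place, and moving \<open>y\<^sub>i\<close> past a
  whole word \<open>p\<close> costs a single commutator with \<open>p\<close>.  So what holds for the multiples of
  commutators of even elements, and is stable under sums, holds for the difference of two words with
  the same letters.
\<close>

lemma rearrangement_induct:
  fixes P :: "'k::comm_ring_1 free_alg \<Rightarrow> bool"
  assumes P0: "P 0" and Padd: "\<And>f g. P f \<Longrightarrow> P g \<Longrightarrow> P (f + g)"
    and Pcomm: "\<And>a b e q. a \<in> even_part \<Longrightarrow> b \<in> even_part \<Longrightarrow> e \<in> even_part \<Longrightarrow> q \<in> even_part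
      \<Longrightarrow> P (e * comm a b * q)"
    and "mset l = mset l'"
  shows "P (yword l - yword l')"
proof -
  have "P (e * (yword l - yword l'))" if "e \<in> even_part" for e
    using \<open>mset l = mset l'\<close> that
  proof (induction l arbitrary: l' e)
    case Nil
    then show ?case by (simp add: P0)
  next
    case (Cons i l)
    then obtain p q where l': "l' = p @ i # q"
      by (metis list.set_intros(1) mset_eq_setD split_list)
    with Cons.prems have "mset l = mset (p @ q)" by simp
    then have "P (e * y i * (yword l - yword (p @ q)))"
      using Cons.IH Cons.prems even_mult y_even by blast
    moreover have "P (e * comm (y i) (yword p) * yword q)"
      using Cons.prems by (intro Pcomm y_even yword_even)
    ultimately have "P (e * y i * (yword l - yword (p @ q)) + e * comm (y i) (yword p) * yword q)"
      by (rule Padd)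
    moreover have "e * y i * (yword l - yword (p @ q)) + e * comm (y i) (yword p) * yword q
      = e * (yword (i # l) - yword l')"
      by (simp add: l' comm_def algebra_simps)
    ultimately show ?case by simp
  qed
  from this[OF one_even] show ?thesis by simp
qed

definition sorted_word :: "nat multiset \<Rightarrow> 'k::ring_1 free_alg"
  where "sorted_word M = yword (sorted_list_of_multiset M)"

lemma sorted_word_even: "sorted_word M \<in> even_part"
  by (simp add: sorted_word_def yword_even)

lemma sorted_word_empty [simp]: "sorted_word {#} = 1"
  by (simp add: sorted_word_def)

text \<open>
  The error made when the letter \<open>d\<close> is inserted into a sorted prefix.  The letters to the right are
  sorted as well, so that the term is a function of two multisets and a letter.
\<close>

definition sorting_step :: "nat multiset \<Rightarrow> nat \<Rightarrow> nat multiset \<Rightarrow> 'k::ring_1 free_alg"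
  where "sorting_step M d N = (sorted_word M * y d - sorted_word (add_mset d M)) * sorted_word N"

definition sorting_sum :: "nat multiset \<Rightarrow> nat list \<Rightarrow> 'k::ring_1 free_alg"
  where "sorting_sum M u =
    (\<Sum>k<length u. sorting_step (M + mset (take k u)) (u ! k) (mset (drop (Suc k) u)))"

lemma sorting_sum_Cons:
  "sorting_sum M (d # u) = sorting_step M d (mset u) + sorting_sum (add_mset d M) u"
  by (simp add: sorting_sum_def sum.lessThan_Suc_shift del: sum.lessThan_Suc)

text \<open>
  The identities themselves are an instance of this locale, so the fact that words with two odd
  variables lie in the ideal also shows that they evaluate to zero.
\<close>

locale T_ideal_with_generators =
  fixes J :: "'k::comm_ring_1 free_alg set"
  assumes T_ideal: "graded_T_ideal J"
    and generators: "{z 1 * z 2, comm (y 1) (y 2) * comm (y 3) (y 4), z 1 * comm (y 1) (y 2),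
      comm (comm (y 1) (y 2) * z 1) (y 3)} \<subseteq> J"
begin

lemma J_0: "0 \<in> J"
  and J_add: "f \<in> J \<Longrightarrow> g \<in> J \<Longrightarrow> f + g \<in> J"
  and J_left: "f \<in> J \<Longrightarrow> h * f \<in> J"
  and J_right: "f \<in> J \<Longrightarrow> f * h \<in> J"
  and J_endo: "f \<in> J \<Longrightarrow> graded_endo \<phi> \<Longrightarrow> \<phi> f \<in> J"
  using T_ideal unfolding graded_T_ideal_def two_sided_ideal_def by blast+

lemma J_diff: "f \<in> J \<Longrightarrow> g \<in> J \<Longrightarrow> f - g \<in> J"
  using J_add[of f "-1 * g"] J_left[of g "-1"] by simp

lemma J_sum: "(\<And>i. i \<in> S \<Longrightarrow> f i \<in> J) \<Longrightarrow> sum f S \<in> J"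
  by (induction S rule: infinite_finite_induct) (simp_all add: J_0 J_add)

lemma comm_mult_comm:
  assumes "a \<in> even_part" "b \<in> even_part" "c \<in> even_part" "d \<in> even_part"
  shows "comm a b * comm c d \<in> J"
proof -
  define \<theta> where "\<theta> = case_var (\<lambda>i. if i = 1 then a else if i = 2 then b else if i = 3 then c else d)
    (\<lambda>j. 0 :: 'k free_alg)"
  have "graded_endo (subst \<theta>)"
    by (rule subst_graded) (use assms in \<open>simp_all add: \<theta>_def free_component_0\<close>)
  then have "subst \<theta> (comm (y 1) (y 2) * comm (y 3) (y 4)) \<in> J"
    using generators by (intro J_endo[of _ "subst \<theta>"]) (simp_all only: insert_subset)
  then show ?thesis by (simp add: subst_mult subst_comm \<theta>_def)
qed

lemma odd_mult_comm:
  assumes "g \<in> odd_part" "a \<in> even_part" "b \<in> even_part"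
  shows "g * comm a b \<in> J"
proof -
  define \<theta> where "\<theta> = case_var (\<lambda>i. if i = 1 then a else b) (\<lambda>j. g)"
  have "graded_endo (subst \<theta>)"
    by (rule subst_graded) (use assms in \<open>simp_all add: \<theta>_def\<close>)
  then have "subst \<theta> (z 1 * comm (y 1) (y 2)) \<in> J"
    using generators by (intro J_endo[of _ "subst \<theta>"]) (simp_all only: insert_subset)
  then show ?thesis by (simp add: subst_mult subst_comm \<theta>_def)
qed

lemma odd_mult_odd:
  assumes "g \<in> odd_part" "h \<in> odd_part"
  shows "g * h \<in> J"
proof -
  define \<theta> where "\<theta> = case_var (\<lambda>i. 0) (\<lambda>j. if j = 1 then g else h)"
  have "graded_endo (subst \<theta>)"
    by (rule subst_graded) (use assms in \<open>simp_all add: \<theta>_def free_component_0\<close>)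
  then have "subst \<theta> (z 1 * z 2) \<in> J"
    using generators by (intro J_endo[of _ "subst \<theta>"]) (simp_all only: insert_subset)
  then show ?thesis by (simp add: subst_mult \<theta>_def)
qed

lemma comm_comm_odd_even:
  assumes "g \<in> odd_part" "a \<in> even_part" "b \<in> even_part" "c \<in> even_part"
  shows "comm (comm a b * g) c \<in> J"
proof -
  define \<theta> where "\<theta> = case_var (\<lambda>i. if i = 1 then a else if i = 2 then b else c) (\<lambda>j. g)"
  have "graded_endo (subst \<theta>)"
    by (rule subst_graded) (use assms in \<open>simp_all add: \<theta>_def\<close>)
  then have "subst \<theta> (comm (comm (y 1) (y 2) * z 1) (y 3)) \<in> J"
    using generators by (intro J_endo[of _ "subst \<theta>"]) (simp_all only: insert_subset)
  then show ?thesis by (simp add: subst_mult subst_comm \<theta>_def)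
qed

text \<open>
  The factor between the commutators is absorbed by the Leibniz rule for the commutator.
\<close>

lemma comm_mult_even_mult_comm:
  assumes "a \<in> even_part" "b \<in> even_part" "q \<in> even_part" "c \<in> even_part" "d \<in> even_part"
  shows "comm a b * q * comm c d \<in> J"
proof -
  have "comm a (b * q) * comm c d - b * (comm a q * comm c d) \<in> J"
    using assms by (intro J_diff J_left comm_mult_comm even_mult)
  also have "comm a (b * q) * comm c d - b * (comm a q * comm c d) = comm a b * q * comm c d"
    by (simp add: comm_def algebra_simps)
  finally show ?thesis .
qed

lemma rearrangement_mult_rearrangement:
  assumes "mset l = mset l'" "mset m = mset m'"
  shows "(yword l - yword l') * (yword m - yword m') \<in> J"
  using _ _ _ assms(1)
proof (rule rearrangement_induct[where P = "\<lambda>f. f * (yword m - yword m') \<in> J"])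
  fix a b e q :: "'k free_alg"
  assume ev: "a \<in> even_part" "b \<in> even_part" "e \<in> even_part" "q \<in> even_part"
  show "e * comm a b * q * (yword m - yword m') \<in> J"
    using _ _ _ assms(2)
  proof (rule rearrangement_induct[where P = "\<lambda>f. e * comm a b * q * f \<in> J"])
    fix c d e' r :: "'k free_alg"
    assume "c \<in> even_part" "d \<in> even_part" "e' \<in> even_part" "r \<in> even_part"
    then have "e * (comm a b * (q * e') * comm c d) * r \<in> J"
      using ev by (intro J_left J_right comm_mult_even_mult_comm even_mult)
    then show "e * comm a b * q * (e' * comm c d * r) \<in> J"
      by (simp add: mult.assoc)
  qed (simp_all add: J_0 J_add distrib_left)
qed (simp_all add: J_0 J_add distrib_right)

lemma odd_mult_rearrangement:
  assumes g: "g \<in> odd_part" and "mset l = mset l'"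
  shows "g * (yword l - yword l') \<in> J"
  using _ _ _ assms(2)
proof (rule rearrangement_induct[where P = "\<lambda>f. g * f \<in> J"])
  fix a b e q :: "'k free_alg"
  assume "a \<in> even_part" "b \<in> even_part" "e \<in> even_part" "q \<in> even_part"
  then have "g * e * comm a b * q \<in> J"
    using g by (intro J_right odd_mult_comm odd_even_mult)
  then show "g * (e * comm a b * q) \<in> J"
    by (simp add: mult.assoc)
qed (simp_all add: J_0 J_add distrib_left)

text \<open>
  The fourth polynomial says that a commutator times an odd element commutes with even elements.  An even
  factor \<open>e\<close> in front does no harm, since moving \<open>h\<close> past it creates a second
  commutator.
\<close>

lemma rearrangement_mult_odd_central:
  assumes g: "g \<in> odd_part" and h: "h \<in> even_part" and "mset l = mset l'"
  shows "(yword l - yword l') * g * h - h * (yword l - yword l') * g \<in> J"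
  using _ _ _ assms(3)
proof (rule rearrangement_induct[where P = "\<lambda>f. f * g * h - h * f * g \<in> J"])
  fix f f' :: "'k free_alg"
  assume "f * g * h - h * f * g \<in> J" "f' * g * h - h * f' * g \<in> J"
  from J_add[OF this] show "(f + f') * g * h - h * (f + f') * g \<in> J"
    by (simp add: algebra_simps)
next
  fix a b e q :: "'k free_alg"
  assume "a \<in> even_part" "b \<in> even_part" "e \<in> even_part" "q \<in> even_part"
  then have "e * comm (comm a b * (q * g)) h + comm e h * comm a b * (q * g) \<in> J"
    using g h by (intro J_add J_left J_right comm_comm_odd_even comm_mult_comm even_odd_mult)
  also have "e * comm (comm a b * (q * g)) h + comm e h * comm a b * (q * g)
    = e * comm a b * q * g * h - h * (e * comm a b * q) * g"
    by (simp add: comm_def[of "_ * _"] comm_def[of e] algebra_simps)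
  finally show "e * comm a b * q * g * h - h * (e * comm a b * q) * g \<in> J" .
qed (simp add: J_0)

text \<open>
  The telescoping sum.  The prefix \<open>M\<close> is the part that is sorted already; the induction moves the
  first letter of \<open>u\<close> into it.
\<close>

lemma sorting_formula:
  "sorted_word M * yword u - sorted_word (M + mset u) - sorting_sum M u \<in> J"
proof (induction u arbitrary: M)
  case Nil
  then show ?case by (simp add: sorting_sum_def J_0)
next
  case (Cons d u)
  define \<delta> :: "'k free_alg" where "\<delta> = sorted_word M * y d - sorted_word (add_mset d M)"
  have "(yword (sorted_list_of_multiset M @ [d]) - yword (sorted_list_of_multiset (add_mset d M)))
      * (yword u - yword (sorted_list_of_multiset (mset u))) \<in> J"
    by (intro rearrangement_mult_rearrangement) simp_all
  then have "\<delta> * (yword u - sorted_word (mset u)) \<in> J"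
    by (simp add: \<delta>_def sorted_word_def)
  from J_add[OF this Cons.IH[of "add_mset d M"]] show ?case
    by (simp add: sorting_sum_Cons sorting_step_def \<delta>_def algebra_simps)
qed

text \<open>
  After \<open>v\<close> has been sorted and moved to the front of the difference of \<open>u\<close> and its sorted form,
  the sorting formula with prefix \<open>v\<close> applies to both words.  The leading sorted words
  cancel, and the sorting sum of the sorted word of \<open>u\<close> is a function of the two multisets.
\<close>

lemma one_z_formula:
  "yword u * z j * yword v -
    (sorted_word (mset u) * z j * sorted_word (mset v)
      - sorting_sum (mset v) (sorted_list_of_multiset (mset u)) * z j
      + sorting_sum (mset v) u * z j) \<in> J"
proof -
  let ?u = "sorted_list_of_multiset (mset u)" and ?v = "sorted_word (mset v) :: 'k free_alg"
  have "(yword u * z j) * (yword v - yword (sorted_list_of_multiset (mset v))) \<in> J"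
    by (intro odd_mult_rearrangement even_odd_mult yword_even z_odd) simp
  then have 1: "(yword u * z j) * (yword v - ?v) \<in> J"
    by (simp add: sorted_word_def)
  have 2: "(yword u - yword ?u) * z j * ?v - ?v * (yword u - yword ?u) * z j \<in> J"
    by (intro rearrangement_mult_odd_central z_odd sorted_word_even) simp
  have 3: "((?v * yword u - sorted_word (mset v + mset u) - sorting_sum (mset v) u)
      - (?v * yword ?u - sorted_word (mset v + mset ?u) - sorting_sum (mset v) ?u)) * z j \<in> J"
    by (intro J_right J_diff sorting_formula)
  show ?thesis
    using J_add[OF J_add[OF 1 2] 3]
    by (simp add: sorted_word_def[of "mset u"] algebra_simps)
qed

lemma two_z_word: "word (p @ Z i # map Y q @ Z j # r) \<in> J"
proof -
  have "word p * ((z i * yword q) * z j) * word r \<in> J"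
    by (intro J_left J_right odd_mult_odd odd_even_mult z_odd yword_even)
  then show ?thesis
    by (simp add: word_append word_Cons yword_def mult.assoc)
qed

end

section \<open>Words by their number of odd variables\<close>

definition ymon :: "nat list \<Rightarrow> mon"
  where "ymon l = Mon (map Y l)"

definition zmon :: "nat list \<times> nat \<times> nat list \<Rightarrow> mon"
  where "zmon = (\<lambda>(u, j, v). Mon (map Y u @ Z j # map Y v))"

lemma inj_ymon: "inj ymon"
proof (rule injI)
  fix l k assume "ymon l = ymon k"
  then show "l = k"
    by (induction l k rule: list_induct2') (auto simp: ymon_def)
qed

lemma inj_zmon: "inj zmon"
proof -
  have "u = u' \<and> j = j' \<and> v = v'" if "zmon (u, j, v) = zmon (u', j', v')" for u j v u' j' v'
    using that
  proof (induction u u' rule: list_induct2')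
    case 1
    then show ?case using inj_ymon by (auto simp: zmon_def ymon_def inj_def)
  qed (auto simp: zmon_def)
  then show ?thesis by (auto intro!: injI)
qed

lemma ymon_ne_zmon: "ymon l \<noteq> zmon t"
proof (cases t)
  case (fields u j v)
  have "Z j \<in> set (vars (zmon t))" "Z j \<notin> set (vars (ymon l))"
    by (auto simp: fields zmon_def ymon_def)
  then show ?thesis by metis
qed

lemma mon_cases [case_names no_z one_z two_z]:
  obtains l where "w = ymon l" | u j v where "w = zmon (u, j, v)"
  | p i q j r where "w = Mon (p @ Z i # map Y q @ Z j # r)"
proof -
  have split: "(\<exists>u. l = map Y u) \<or> (\<exists>u j r. l = map Y u @ Z j # r)" for l
  proof (induction l)
    case (Cons v l)
    show ?case
    proof (cases v)
      case (Y i)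
      from Cons.IH show ?thesis
      proof (elim disjE exE)
        fix u assume "l = map Y u"
        then have "v # l = map Y (i # u)" using Y by simp
        then show ?thesis by (intro disjI1 exI)
      next
        fix u j r assume "l = map Y u @ Z j # r"
        then have "v # l = map Y (i # u) @ Z j # r" using Y by simp
        then show ?thesis by (intro disjI2 exI)
      qed
    next
      case (Z j)
      then have "v # l = map Y [] @ Z j # l" by simp
      then show ?thesis by (intro disjI2 exI)
    qed
  qed simp
  show thesis
    using split[of "vars w"]
  proof (elim disjE exE)
    fix l assume "vars w = map Y l"
    then have "w = ymon l" by (metis mon.collapse ymon_def)
    then show thesis by (rule that(1))
  next
    fix u j r assume w: "vars w = map Y u @ Z j # r"
    show thesis
      using split[of r]
    proof (elim disjE exE)
      fix v assume "r = map Y v"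
      with w have "w = zmon (u, j, v)" by (metis case_prod_conv mon.collapse zmon_def)
      then show thesis by (rule that(2))
    next
      fix q k r' assume "r = map Y q @ Z k # r'"
      with w have "w = Mon (map Y u @ Z j # map Y q @ Z k # r')" by (metis mon.collapse)
      then show thesis by (rule that(3))
    qed
  qed
qed

text \<open>
  The third sum collects the words with at least two odd variables.
\<close>

lemma sum_over_keys:
  fixes h :: "mon \<Rightarrow> 'b::comm_monoid_add"
  shows "(\<Sum>w\<in>keys f. h w) = (\<Sum>l\<in>ymon -` keys f. h (ymon l)) + (\<Sum>t\<in>zmon -` keys f. h (zmon t))
    + (\<Sum>w\<in>keys f - range ymon - range zmon. h w)"
proof -
  have fin: "finite (keys f)" by simp
  have "(\<Sum>w\<in>keys f. h w) = (\<Sum>w\<in>keys f \<inter> range ymon. h w) + (\<Sum>w\<in>keys f - range ymon. h w)"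
    using sum.Int_Diff[OF fin] .
  also have "(\<Sum>w\<in>keys f - range ymon. h w)
    = (\<Sum>w\<in>(keys f - range ymon) \<inter> range zmon. h w) + (\<Sum>w\<in>keys f - range ymon - range zmon. h w)"
    by (rule sum.Int_Diff) simp
  also have "(keys f - range ymon) \<inter> range zmon = zmon ` (zmon -` keys f)"
    using ymon_ne_zmon by (auto simp del: split_paired_All) (metis ymon_ne_zmon)
  also have "keys f \<inter> range ymon = ymon ` (ymon -` keys f)"
    by auto
  finally show ?thesis
    by (simp add: sum.reindex inj_on_subset[OF inj_ymon] inj_on_subset[OF inj_zmon] add.assoc
        del: image_vimage_eq)
qed

lemma finite_ymon_keys: "finite (ymon -` keys f)" and finite_zmon_keys: "finite (zmon -` keys f)"
  by (simp_all add: finite_vimageI inj_ymon inj_zmon)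

section \<open>Evaluation at a generic point\<close>

datatype entry = is_E11: E11 (idx: nat) | is_E22: E22 (idx: nat) | is_E12: E12 (idx: nat)
  | is_E23: E23 (idx: nat)

text \<open>
  The coordinates \<open>E11\<close>, \<open>E22\<close>, \<open>E12\<close> and \<open>E23\<close> of all variables are independent.
  The coordinate of the odd variables at \<open>e\<^sub>1\<^sub>3\<close> is set to zero, so that the (1,3) entry
  of \<open>u z\<^sub>j v\<close> sees \<open>u\<close> through its (1,2) entry alone.
\<close>

definition generic_point :: "(entry \<Rightarrow> 'k::field) \<Rightarrow> var \<Rightarrow> 'k^3^3"
  where "generic_point x = case_var
    (\<lambda>i. \<chi> a b. if a = b then (if a = 2 then x (E22 i) else x (E11 i))
      else if a = 1 \<and> b = 2 then x (E12 i) else 0)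
    (\<lambda>j. \<chi> a b. if a = 2 \<and> b = 3 then x (E23 j) else 0)"

lemma graded_point_generic: "graded_point (generic_point x)"
  by (simp add: graded_point_def generic_point_def mem_A mem_A\<^sub>0 mem_A\<^sub>1)

text \<open>
  The (1,2) entry of a product of even matrices is a noncommutative derivative: one factor
  contributes its (1,2) entry, the factors to its left their (1,1) entry and those to its right their
  (2,2) entry.
\<close>

definition fox_monomial :: "nat multiset \<Rightarrow> nat \<Rightarrow> nat multiset \<Rightarrow> entry multiset"
  where "fox_monomial M d N = image_mset E11 M + {#E12 d#} + image_mset E22 N"

text \<open>
  The constructors of \<^typ>\<open>entry\<close> keep the coordinates apart, so each multiset can be recovered by
  filtering.  With suitable arguments this also separates the simpler monomials of the other entries.
\<close>

lemma fox_monomial_inject: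
  "fox_monomial M d N + image_mset E23 L = fox_monomial M' d' N' + image_mset E23 L' \<longleftrightarrow>
    M = M' \<and> d = d' \<and> N = N' \<and> L = L'"
proof
  assume eq: "fox_monomial M d N + image_mset E23 L = fox_monomial M' d' N' + image_mset E23 L'"
  have part: "image_mset idx (filter_mset is_E11 (fox_monomial M d N + image_mset E23 L)) = M"
    "image_mset idx (filter_mset is_E12 (fox_monomial M d N + image_mset E23 L)) = {#d#}"
    "image_mset idx (filter_mset is_E22 (fox_monomial M d N + image_mset E23 L)) = N"
    "image_mset idx (filter_mset is_E23 (fox_monomial M d N + image_mset E23 L)) = L"
    for M d N L
    by (simp_all add: fox_monomial_def filter_mset_image_mset multiset.map_comp o_def)
  show "M = M' \<and> d = d' \<and> N = N' \<and> L = L'"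
    using part[of M d N L] part[of M' d' N' L'] unfolding eq by simp
qed simp

lemma generic_value_ymon:
  fixes x :: "entry \<Rightarrow> 'k::field"
  shows "eval_mon (generic_point x) (ymon l) =
    (\<chi> a b. if a = b
        then (if a = 2 then monomial_fun x (image_mset E22 (mset l))
              else monomial_fun x (image_mset E11 (mset l)))
      else if a = 1 \<and> b = 2
        then (\<Sum>k<length l.
          monomial_fun x (fox_monomial (mset (take k l)) (l ! k) (mset (drop (Suc k) l))))
      else 0)"
proof (induction l)
  case Nil
  show ?case
    by (simp add: ymon_def eval_mon_Nil mat_def vec_eq_iff forall_3)
next
  case (Cons i l)
  have "eval_mon (generic_point x) (ymon (i # l))
      = generic_point x (Y i) ** eval_mon (generic_point x) (ymon l)"
    by (simp add: ymon_def eval_mon_Cons)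
  moreover have "generic_point x (Y i) = (\<chi> a b. if a = b then (if a = 2 then x (E22 i) else x (E11 i))
      else if a = 1 \<and> b = 2 then x (E12 i) else 0)"
    by (simp add: generic_point_def)
  ultimately show ?case
    by (simp add: Cons matrix_matrix_mult_def sum_3 vec_eq_iff forall_3
        fox_monomial_def sum.lessThan_Suc_shift sum_distrib_left mult_ac del: sum.lessThan_Suc)
qed

lemma generic_value_zmon:
  fixes x :: "entry \<Rightarrow> 'k::field"
  shows "eval_mon (generic_point x) (zmon (u, j, v)) =
    (\<chi> a b. if a = 1 \<and> b = 3
        then (\<Sum>k<length u. monomial_fun x
          (fox_monomial (mset v + mset (take k u)) (u ! k) (mset (drop (Suc k) u)) + {#E23 j#}))
      else if a = 2 \<and> b = 3
        then monomial_fun x (image_mset E22 (mset u) + {#E23 j#} + image_mset E11 (mset v))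
      else 0)"
proof -
  have "zmon (u, j, v) = ymon u + (Mon [Z j] + ymon v)"
    by (simp add: zmon_def ymon_def plus_mon_def)
  then have "eval_mon (generic_point x) (zmon (u, j, v)) = eval_mon (generic_point x) (ymon u) **
      (generic_point x (Z j) ** eval_mon (generic_point x) (ymon v))"
    by (simp add: eval_mon_add eval_mon_Cons[of _ _ "[]"] eval_mon_Nil)
  moreover have "generic_point x (Z j) = (\<chi> a b. if a = 2 \<and> b = 3 then x (E23 j) else 0)"
    by (simp add: generic_point_def)
  ultimately show ?thesis
    by (simp add: generic_value_ymon matrix_matrix_mult_def sum_3 vec_eq_iff forall_3
        fox_monomial_def sum_distrib_left sum_distrib_right mult_ac)
qed

section \<open>Every graded identity follows from the four polynomials\<close>

lemma T_ideal_identities: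
  "T_ideal_with_generators (graded_identities A\<^sub>0 A\<^sub>1 :: 'k::field free_alg set)"
  by (rule T_ideal_with_generators.intro[OF graded_T_ideal_identities generators_are_identities])

lemma identity_entries:
  fixes f :: "'k::field free_alg"
  assumes f: "f \<in> graded_identities A\<^sub>0 A\<^sub>1"
  shows "(\<Sum>l\<in>ymon -` keys f. coeff f (ymon l) * eval_mon (generic_point x) (ymon l) $ a $ b)
    + (\<Sum>t\<in>zmon -` keys f. coeff f (zmon t) * eval_mon (generic_point x) (zmon t) $ a $ b) = 0"
proof -
  \<comment> \<open>the ideal of identities contains the words with two odd variables\<close>
  have "eval_mon (generic_point x) w = 0" if "w \<notin> range ymon" "w \<notin> range zmon" for w
  proof (cases w rule: mon_cases)
    case (two_z p i q j r)
    have "word (p @ Z i # map Y q @ Z j # r) \<in> (graded_identities A\<^sub>0 A\<^sub>1 :: 'k free_alg set)"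
      using T_ideal_with_generators.two_z_word[OF T_ideal_identities] .
    then show ?thesis
      using graded_point_generic[of x] by (simp add: mem_graded_identities eval_word two_z)
  qed (use that in auto)
  then have "(\<Sum>w\<in>keys f - range ymon - range zmon.
      coeff f w * eval_mon (generic_point x) w $ a $ b) = 0"
    by (intro sum.neutral) simp
  moreover have "(\<Sum>w\<in>keys f. coeff f w * eval_mon (generic_point x) w $ a $ b) = 0"
  proof -
    have "eval (generic_point x) f $ a $ b = 0"
      using f graded_point_generic[of x] by (simp add: mem_graded_identities)
    then show ?thesis
      by (simp add: eval_def mat_scale_def)
  qed
  ultimately show ?thesis
    using sum_over_keys[of "\<lambda>w. coeff f w * eval_mon (generic_point x) w $ a $ b" f] by simp
qed

lemma (in T_ideal_with_generators) reduction_mod_J: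
  "f - ((\<Sum>l\<in>ymon -` keys f. const (coeff f (ymon l)) * (sorted_word (mset l) + sorting_sum {#} l))
    + (\<Sum>(u, j, v)\<in>zmon -` keys f. const (coeff f (zmon (u, j, v))) *
        (sorted_word (mset u) * z j * sorted_word (mset v)
          - sorting_sum (mset v) (sorted_list_of_multiset (mset u)) * z j
          + sorting_sum (mset v) u * z j))) \<in> J"
proof -
  define R :: "nat list \<times> nat \<times> nat list \<Rightarrow> 'k free_alg" where "R = (\<lambda>(u, j, v).
    sorted_word (mset u) * z j * sorted_word (mset v)
      - sorting_sum (mset v) (sorted_list_of_multiset (mset u)) * z j
      + sorting_sum (mset v) u * z j)"
  have y_words: "word (vars (ymon l)) - (sorted_word (mset l) + sorting_sum {#} l) \<in> J" for l
    using sorting_formula[of "{#}" l] by (simp add: ymon_def yword_def algebra_simps)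
  have z_words: "word (vars (zmon t)) - R t \<in> J" for t
    using one_z_formula
    by (cases t) (simp add: R_def zmon_def yword_def word_append word_Cons mult.assoc)
  have rest: "word (vars w) \<in> J" if "w \<notin> range ymon" "w \<notin> range zmon" for w
  proof (cases w rule: mon_cases)
    case (two_z p i q j r)
    then show ?thesis using two_z_word by simp
  qed (use that in auto)
  have "f = (\<Sum>l\<in>ymon -` keys f. const (coeff f (ymon l)) * word (vars (ymon l)))
    + (\<Sum>t\<in>zmon -` keys f. const (coeff f (zmon t)) * word (vars (zmon t)))
    + (\<Sum>w\<in>keys f - range ymon - range zmon. const (coeff f w) * word (vars w))"
    using poly_expand[of f] sum_over_keys[of "\<lambda>w. const (coeff f w) * word (vars w)" f] by simp
  then have "f - ((\<Sum>l\<in>ymon -` keys f. const (coeff f (ymon l)) * (sorted_word (mset l) + sorting_sum {#} l))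
      + (\<Sum>t\<in>zmon -` keys f. const (coeff f (zmon t)) * R t))
    = (\<Sum>l\<in>ymon -` keys f. const (coeff f (ymon l)) *
        (word (vars (ymon l)) - (sorted_word (mset l) + sorting_sum {#} l)))
    + (\<Sum>t\<in>zmon -` keys f. const (coeff f (zmon t)) * (word (vars (zmon t)) - R t))
    + (\<Sum>w\<in>keys f - range ymon - range zmon. const (coeff f w) * word (vars w))"
    by (simp add: right_diff_distrib sum_subtractf)
  also have "\<dots> \<in> J"
    by (intro J_add J_sum J_left y_words z_words rest) auto
  finally show ?thesis
    by (simp add: R_def split_beta)
qed


text \<open>
  By the reduction modulo \<open>J\<close> it suffices that four sums vanish.  Each of them is transferred from
  one entry of the value at the generic point, whose monomials determine the terms of the sum.
\<close>

lemma identities_subset_T_ideal: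
  fixes J :: "'k::field_char_0 free_alg set"
  assumes "T_ideal_with_generators J"
  shows "graded_identities A\<^sub>0 A\<^sub>1 \<subseteq> J"
proof
  interpret T_ideal_with_generators J by fact
  fix f :: "'k free_alg"
  assume f: "f \<in> graded_identities A\<^sub>0 A\<^sub>1"
  let ?I = "ymon -` keys f" and ?I' = "zmon -` keys f"
  have fin: "finite ?I" "finite ?I'"
    by (rule finite_ymon_keys finite_zmon_keys)+
  have entry11: "eval_mon (generic_point x) (zmon t) $ 1 $ 1 = 0"
    and entry12: "eval_mon (generic_point x) (zmon t) $ 1 $ 2 = 0" for x :: "entry \<Rightarrow> 'k" and t
    by (cases t; simp add: generic_value_zmon)+
  have sorted_y: "(\<Sum>l\<in>?I. const (coeff f (ymon l)) * sorted_word (mset l)) = 0"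
  proof (rule monomial_relation_transfer[where M = "\<lambda>l. image_mset E11 (mset l)", OF fin(1)])
    fix x :: "entry \<Rightarrow> 'k"
    show "(\<Sum>l\<in>?I. coeff f (ymon l) * monomial_fun x (image_mset E11 (mset l))) = 0"
      using identity_entries[OF f, of x 1 1] by (simp add: generic_value_ymon entry11)
  next
    fix l l' :: "nat list"
    assume "image_mset E11 (mset l) = image_mset E11 (mset l')"
    \<comment> \<open>both sides are completed to monomials of the general shape by the factor \<open>E12 0\<close>\<close>
    then have "mset l = mset l'"
      using fox_monomial_inject[of "mset l" 0 "{#}" "{#}" "mset l'" 0 "{#}" "{#}"]
      by (simp add: fox_monomial_def)
    then show "sorted_word (mset l) = (sorted_word (mset l') :: 'k free_alg)" by simp
  qed
  have steps_y: "(\<Sum>l\<in>?I. const (coeff f (ymon l)) * sorting_sum {#} l) = 0"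
  proof -
    let ?S = "SIGMA l:?I. {..<length l}"
    let ?M = "\<lambda>(l, k). fox_monomial (mset (take k l)) (l ! k) (mset (drop (Suc k) l))"
    let ?T = "\<lambda>(l, k). sorting_step (mset (take k l)) (l ! k) (mset (drop (Suc k) l)) :: 'k free_alg"
    have "(\<Sum>p\<in>?S. const (coeff f (ymon (fst p))) * ?T p) = 0"
    proof (rule monomial_relation_transfer[where M = ?M])
      show "finite ?S" using fin by simp
    next
      fix x :: "entry \<Rightarrow> 'k"
      show "(\<Sum>p\<in>?S. coeff f (ymon (fst p)) * monomial_fun x (?M p)) = 0"
        using identity_entries[OF f, of x 1 2] fin
        by (simp add: generic_value_ymon entry12 sum_distrib_left sum.Sigma split_beta)
    next
      fix p p' :: "nat list \<times> nat"
      assume "?M p = ?M p'"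
      then show "?T p = ?T p'"
        using fox_monomial_inject[where L = "{#}" and L' = "{#}"] by (auto simp: split_beta)
    qed
    then show ?thesis
      using fin by (simp add: sorting_sum_def sum_distrib_left sum.Sigma split_beta)
  qed
  have sorted_z: "(\<Sum>t\<in>?I'. const (coeff f (zmon t)) * (case t of (u, j, v) \<Rightarrow>
      sorted_word (mset u) * z j * sorted_word (mset v)
        - sorting_sum (mset v) (sorted_list_of_multiset (mset u)) * z j)) = 0"
  proof -
    let ?M = "\<lambda>(u, j, v). image_mset E22 (mset u) + {#E23 j#} + image_mset E11 (mset v)"
    let ?T = "\<lambda>(u, j, v). sorted_word (mset u) * z j * sorted_word (mset v)
        - sorting_sum (mset v) (sorted_list_of_multiset (mset u)) * z j :: 'k free_alg"
    show ?thesis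
    proof (rule monomial_relation_transfer[where M = ?M, OF fin(2)])
      fix x :: "entry \<Rightarrow> 'k"
      have "eval_mon (generic_point x) (zmon t) $ 2 $ 3 = monomial_fun x (?M t)" for t
        by (cases t) (simp add: generic_value_zmon)
      then show "(\<Sum>t\<in>?I'. coeff f (zmon t) * monomial_fun x (?M t)) = 0"
        using identity_entries[OF f, of x 2 3] by (simp add: generic_value_ymon)
    next
      have inject: "u = u' \<and> j = j' \<and> v = v'"
        if "image_mset E22 u + {#E23 j#} + image_mset E11 v
          = image_mset E22 u' + {#E23 j'#} + image_mset E11 v'" for u v u' v' j j'
        using fox_monomial_inject[of v 0 u "{#j#}" v' 0 u' "{#j'#}"] that
        by (simp add: fox_monomial_def add_ac)
      fix t t' :: "nat list \<times> nat \<times> nat list"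
      assume "?M t = ?M t'"
      then have "mset (fst t) = mset (fst t') \<and> fst (snd t) = fst (snd t')
          \<and> mset (snd (snd t)) = mset (snd (snd t'))"
        unfolding split_beta by (rule inject)
      then show "?T t = ?T t'"
        unfolding split_beta by (elim conjE) (simp only:)
    qed
  qed
  have steps_z: "(\<Sum>t\<in>?I'. const (coeff f (zmon t)) *
      (case t of (u, j, v) \<Rightarrow> sorting_sum (mset v) u * z j)) = 0"
  proof -
    let ?S = "SIGMA t:?I'. {..<length (fst t)}"
    let ?M = "\<lambda>((u, j, v), k).
      fox_monomial (mset v + mset (take k u)) (u ! k) (mset (drop (Suc k) u)) + {#E23 j#}"
    let ?T = "\<lambda>((u, j, v), k).
      sorting_step (mset v + mset (take k u)) (u ! k) (mset (drop (Suc k) u)) * z j :: 'k free_alg"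
    have "(\<Sum>p\<in>?S. const (coeff f (zmon (fst p))) * ?T p) = 0"
    proof (rule monomial_relation_transfer[where M = ?M])
      show "finite ?S" using fin by simp
    next
      fix x :: "entry \<Rightarrow> 'k"
      have "eval_mon (generic_point x) (zmon t) $ 1 $ 3
          = (\<Sum>k<length (fst t). monomial_fun x (?M (t, k)))" for t
        by (cases t) (simp add: generic_value_zmon)
      then show "(\<Sum>p\<in>?S. coeff f (zmon (fst p)) * monomial_fun x (?M p)) = 0"
        using identity_entries[OF f, of x 1 3] fin
        by (simp add: generic_value_ymon sum_distrib_left sum.Sigma split_beta)
    next
      have inject: "M = M' \<and> d = d' \<and> N = N' \<and> j = j'"
        if "fox_monomial M d N + {#E23 j#} = fox_monomial M' d' N' + {#E23 j'#}"
        for M d N j M' d' N' j'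
        using fox_monomial_inject[of M d N "{#j#}" M' d' N' "{#j'#}"] that by simp
      fix p p' :: "(nat list \<times> nat \<times> nat list) \<times> nat"
      assume "?M p = ?M p'"
      from this[unfolded split_beta] show "?T p = ?T p'"
        unfolding split_beta by (elim inject[THEN conjE] conjE) (simp only:)
    qed
    then show ?thesis
      using fin by (simp add: sorting_sum_def sum_distrib_left sum_distrib_right sum.Sigma split_beta)
  qed
  have "(\<Sum>(u, j, v)\<in>?I'. const (coeff f (zmon (u, j, v))) *
        (sorted_word (mset u) * z j * sorted_word (mset v)
          - sorting_sum (mset v) (sorted_list_of_multiset (mset u)) * z j
          + sorting_sum (mset v) u * z j)) = 0"
    using arg_cong2[OF sorted_z steps_z, of "(+)"]
    by (simp add: sum.distrib[symmetric] distrib_left[symmetric] split_beta)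
  moreover have "(\<Sum>l\<in>?I. const (coeff f (ymon l)) * (sorted_word (mset l) + sorting_sum {#} l)) = 0"
    by (simp add: distrib_left sum.distrib sorted_y steps_y)
  ultimately show "f \<in> J"
    using reduction_mod_J[of f] by simp
qed

theorem theorem3:
  shows "(graded_identities A\<^sub>0 A\<^sub>1 :: 'k::field_char_0 free_alg set) =
    graded_T_ideal hull
      {z 1 * z 2,
       comm (y 1) (y 2) * comm (y 3) (y 4),
       z 1 * comm (y 1) (y 2),
       comm (comm (y 1) (y 2) * z 1) (y 3)}"
proof
  show "graded_identities A\<^sub>0 A\<^sub>1 \<subseteq> graded_T_ideal hull
      {z 1 * z 2, comm (y 1) (y 2) * comm (y 3) (y 4), z 1 * comm (y 1) (y 2),
       comm (comm (y 1) (y 2) * z 1 :: 'k free_alg) (y 3)}"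
    unfolding hull_def
    using identities_subset_T_ideal by (blast intro: T_ideal_with_generators.intro)
  show "graded_T_ideal hull
      {z 1 * z 2, comm (y 1) (y 2) * comm (y 3) (y 4), z 1 * comm (y 1) (y 2),
       comm (comm (y 1) (y 2) * z 1 :: 'k free_alg) (y 3)} \<subseteq> graded_identities A\<^sub>0 A\<^sub>1"
    by (intro hull_minimal generators_are_identities graded_T_ideal_identities)
qed

end
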